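(* Let $k\ge2$ and let $\mu_1,\ldots,\mu_k$ be non-zero, finite, compactly supported Borel measures on $\mathbb{R}^d$. Let $q\in[1,\infty]$. If for some $p\in[1,\infty]$ the estimate $$\big\|\widehat{f_1\,d\mu_1}\cdots\widehat{f_k\,d\mu_k}\big\|_{L^q(\mathbb{R}^d)}\lesssim\prod_{m=1}^k\|f_m\|_{L^p(d\mu_m)}$$ holds for all $f_m\in L^p(d\mu_m)$, $m=1,\ldots,k$, then $$q\ge\frac{2d}{\sum_{m=1}^k\overline{\dim}_{\mathrm B}\,\mathrm{supp}(\mu_m)}.$$
   Context: For a finite Borel measure $\mu$ on $\mathbb{R}^d$ and $f\in L^1(\mu)$, $\widehat{f\,d\mu}(\xi)=\int f(x)e^{-2\pi i x\cdot\xi}\,d\mu(x)$. $A\lesssim B$ means $A\le CB$ for a constant $0<C<\infty$, here independent of the functions $f_m$. For a bounded set $X\subseteq\mathbb{R}^d$, the upper box dimension is $\overline{\dim}_{\mathrm B}X=\limsup_{\delta\searrow0}\frac{\log N_\delta(X)}{-\log\delta}$, where $N_\delta(X)$ is the smallest number of sets of diameter $\delta$ needed to cover $X$. If the sum of dimensions is $0$, the right-hand side of the conclusion is read as $\infty$. *)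

theory Defs
  imports "HOL-Probability.Essential_Supremum"
begin

text \<open>
  The Lebesgue norm for exponents in \<open>[1, \<infinity>]\<close>, with values in \<open>[0, \<infinity>]\<close>. The \<open>p\<close>-th root is
  spelled out because \<open>powr\<close> is not available on \<^typ>\<open>ennreal\<close>.
\<close>

definition Lp_norm :: "ereal \<Rightarrow> 'a measure \<Rightarrow> ('a \<Rightarrow> complex) \<Rightarrow> ennreal" where
  "Lp_norm p M f =
     (if p = \<infinity> then esssup M (\<lambda>x. ennreal (norm (f x)))
      else let r = real_of_ereal p; I = (\<integral>\<^sup>+x. ennreal (norm (f x) powr r) \<partial>M)
           in if I = \<infinity> then \<infinity> else ennreal (enn2real I powr (1 / r)))"

definition Lp_space :: "ereal \<Rightarrow> 'a measure \<Rightarrow> ('a \<Rightarrow> complex) set" where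
  "Lp_space p M = {f \<in> borel_measurable M. Lp_norm p M f < \<infinity>}"

text \<open>The Fourier transform of the complex measure \<open>f d\<mu>\<close>.\<close>

definition fourier_density :: "('a::euclidean_space \<Rightarrow> complex) \<Rightarrow> 'a measure \<Rightarrow> 'a \<Rightarrow> complex" where
  "fourier_density f \<mu> \<xi> =
     (\<integral>x. f x * exp (- 2 * complex_of_real pi * \<i> * complex_of_real (x \<bullet> \<xi>)) \<partial>\<mu>)"

definition measure_support :: "'a::topological_space measure \<Rightarrow> 'a set" where
  "measure_support \<mu> = {x. \<forall>U. open U \<longrightarrow> x \<in> U \<longrightarrow> emeasure \<mu> U > 0}"

text \<open>
  Boundedness of the covering sets is required explicitly because \<^const>\<open>diameter\<close> is
  only meaningful on bounded sets. For bounded \<open>X\<close> in a Euclidean space and \<open>\<delta> > 0\<close> a finite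
  cover exists, so the infimum is attained; for unbounded \<open>X\<close> the value is meaningless.
\<close>

definition covering_number :: "real \<Rightarrow> 'a::metric_space set \<Rightarrow> nat" where
  "covering_number \<delta> X =
     Inf {card \<U> | \<U>. finite \<U> \<and> (\<forall>U\<in>\<U>. bounded U \<and> diameter U = \<delta>) \<and> X \<subseteq> \<Union>\<U>}"

definition upper_box_dim :: "'a::metric_space set \<Rightarrow> ereal" where
  "upper_box_dim X =
     Limsup (at_right 0) (\<lambda>\<delta>. ereal (ln (real (covering_number \<delta> X)) / (- ln \<delta>)))"

text \<open>
  In \<^typ>\<open>ereal\<close>, dividing a positive real by \<open>0\<close> gives \<open>\<infinity>\<close>, so quotients by a vanishing
  sum of dimensions are read as \<open>\<infinity>\<close>.
\<close>

lemma ereal_pos_divide_zero: "0 < c \<Longrightarrow> ereal c / 0 = \<infinity>"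
  by (simp add: divide_ereal_def)

end

theory Submission
  imports Defs "HOL-Real_Asymp.Real_Asymp"
begin

text \<open>
  Let the \<open>f\<^sub>m\<close> be random signs on the pieces of a partition of the support into \<open>N\<^sub>m\<close> sets of diameter
  at most \<open>\<delta>\<close>, so that \<open>\<bar>f\<^sub>m\<bar> \<le> 1\<close>. For \<open>\<bar>\<xi>\<bar> \<le> 1 / (4 \<pi> \<delta>)\<close> the exponential hardly oscillates on a piece \<open>Q\<close>,
  which therefore contributes at least \<open>\<mu>\<^sub>m(Q) / 2\<close> in modulus to the Fourier transform. By Khintchine and
  Cauchy-Schwarz the mean of the modulus of the transform of \<open>f\<^sub>m d\<mu>\<^sub>m\<close> at \<open>\<xi>\<close> is \<open>\<greatersim> N\<^sub>m\<^sup>-\<^sup>1\<^sup>/\<^sup>2\<close>. Integrating the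
  product over this ball of volume \<open>\<sim> \<delta>\<^sup>-\<^sup>d\<close>, the estimate gives \<open>\<delta>\<^sup>-\<^sup>d\<^sup>/\<^sup>q \<lesssim> (N\<^sub>1 \<cdots> N\<^sub>k)\<^sup>1\<^sup>/\<^sup>2\<close> for every \<open>\<delta>\<close>, and it
  remains to take logarithms.
\<close>

section \<open>Random signs and Khintchine's inequality\<close>

text \<open>A choice of signs is encoded as the set \<open>A\<close> of indices that carry a plus,
  so an expectation is a sum over \<open>Pow J\<close> divided by \<open>2 ^ card J\<close>, and
  induction on \<open>J\<close> applies.\<close>

definition signed_sum :: "'i set \<Rightarrow> 'i set \<Rightarrow> ('i \<Rightarrow> 'a::real_vector) \<Rightarrow> 'a" where
  "signed_sum A J b = (\<Sum>j\<in>J. if j \<in> A then b j else - b j)"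

lemma sum_Pow_insert:
  assumes "finite J" "x \<notin> J"
  shows "(\<Sum>A\<in>Pow (insert x J). F A) = (\<Sum>A\<in>Pow J. F A + F (insert x A))"
proof -
  have "(\<Sum>A\<in>Pow (insert x J). F A) = (\<Sum>A\<in>Pow J. F A) + (\<Sum>A\<in>insert x ` Pow J. F A)"
    unfolding Pow_insert using assms by (intro sum.union_disjoint) auto
  also have "(\<Sum>A\<in>insert x ` Pow J. F A) = (\<Sum>A\<in>Pow J. F (insert x A))"
    using assms by (intro sum.reindex_cong[of "insert x"]) (auto simp: inj_on_def)
  finally show ?thesis by (simp add: sum.distrib)
qed

lemma signed_sum_insert:
  assumes "finite J" "x \<notin> J" "A \<subseteq> J"
  shows "signed_sum A (insert x J) b = signed_sum A J b - b x"
    and "signed_sum (insert x A) (insert x J) b = signed_sum A J b + b x"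
proof -
  have "x \<notin> A" using assms by auto
  show "signed_sum A (insert x J) b = signed_sum A J b - b x"
    using assms \<open>x \<notin> A\<close> by (simp add: signed_sum_def)
  have "(\<Sum>j\<in>J. if j \<in> insert x A then b j else - b j) = (\<Sum>j\<in>J. if j \<in> A then b j else - b j)"
    using assms by (intro sum.cong) auto
  then show "signed_sum (insert x A) (insert x J) b = signed_sum A J b + b x"
    using assms by (simp add: signed_sum_def)
qed

text \<open>The two signs of a new element are paired, and the parallelogram law cancels the cross
  terms.\<close>

lemma signed_sum_second_moment:
  fixes b :: "'i \<Rightarrow> 'a::real_inner"
  assumes "finite J"
  shows "(\<Sum>A\<in>Pow J. (norm (signed_sum A J b))\<^sup>2) = 2 ^ card J * (\<Sum>j\<in>J. (norm (b j))\<^sup>2)"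
  using assms
proof (induction J)
  case empty
  then show ?case by (simp add: signed_sum_def)
next
  case (insert x J)
  have "(norm (z - y))\<^sup>2 + (norm (z + y))\<^sup>2 = 2 * (norm z)\<^sup>2 + 2 * (norm y)\<^sup>2" for z y :: 'a
    by (simp add: power2_norm_eq_inner algebra_simps)
  then have "(\<Sum>A\<in>Pow (insert x J). (norm (signed_sum A (insert x J) b))\<^sup>2)
      = (\<Sum>A\<in>Pow J. 2 * (norm (signed_sum A J b))\<^sup>2 + 2 * (norm (b x))\<^sup>2)"
    using insert by (simp add: sum_Pow_insert signed_sum_insert)
  also have "\<dots> = 2 * (\<Sum>A\<in>Pow J. (norm (signed_sum A J b))\<^sup>2) + 2 ^ card J * (2 * (norm (b x))\<^sup>2)"
    using insert.hyps by (simp add: sum.distrib sum_distrib_left[symmetric] card_Pow)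
  also have "\<dots> = 2 ^ card (insert x J) * (\<Sum>j\<in>insert x J. (norm (b j))\<^sup>2)"
    unfolding insert.IH using insert.hyps by (simp add: distrib_left)
  finally show ?case .
qed

text \<open>The same pairing of signs; the constant 3 reproduces itself because the mixed term
  \<open>12 * ?y * ?T\<close> arising in the step is exactly that of
  \<open>6 * (?T + ?y)\<^sup>2\<close>.\<close>

lemma signed_sum_fourth_moment:
  fixes b :: "'i \<Rightarrow> 'a::real_inner"
  assumes "finite J"
  shows "(\<Sum>A\<in>Pow J. (norm (signed_sum A J b)) ^ 4) \<le> 3 * 2 ^ card J * (\<Sum>j\<in>J. (norm (b j))\<^sup>2)\<^sup>2"
  using assms
proof (induction J)
  case empty
  then show ?case by (simp add: signed_sum_def)
next
  case (insert x J)
  let ?T = "\<Sum>j\<in>J. (norm (b j))\<^sup>2" and ?y = "(norm (b x))\<^sup>2"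
  have step: "(norm (z - y)) ^ 4 + (norm (z + y)) ^ 4
      \<le> 2 * (norm z) ^ 4 + 12 * (norm y)\<^sup>2 * (norm z)\<^sup>2 + 2 * (norm y) ^ 4" for z y :: 'a
  proof -
    have "(norm (z - y))\<^sup>2 = (norm z)\<^sup>2 + (norm y)\<^sup>2 - 2 * (z \<bullet> y)"
      and "(norm (z + y))\<^sup>2 = (norm z)\<^sup>2 + (norm y)\<^sup>2 + 2 * (z \<bullet> y)"
      by (simp_all add: power2_norm_eq_inner algebra_simps inner_commute)
    then have "(norm (z - y)) ^ 4 + (norm (z + y)) ^ 4
      = ((norm z)\<^sup>2 + (norm y)\<^sup>2 - 2 * (z \<bullet> y))\<^sup>2 + ((norm z)\<^sup>2 + (norm y)\<^sup>2 + 2 * (z \<bullet> y))\<^sup>2"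
      by (metis numeral_Bit0 mult_2 power_mult)
    also have "\<dots> = 2 * (norm z) ^ 4 + 4 * (norm y)\<^sup>2 * (norm z)\<^sup>2 + 2 * (norm y) ^ 4 + 8 * (z \<bullet> y)\<^sup>2"
      by algebra
    \<comment> \<open>Odd powers of the inner product have cancelled; the remaining square raises
      the mixed coefficient from 4 to 4 + 8 = 12.\<close>
    also have "(z \<bullet> y)\<^sup>2 \<le> (norm y)\<^sup>2 * (norm z)\<^sup>2"
      using Cauchy_Schwarz_ineq[of z y] by (simp add: power2_norm_eq_inner mult.commute)
    finally show ?thesis by simp
  qed
  have "(\<Sum>A\<in>Pow (insert x J). (norm (signed_sum A (insert x J) b)) ^ 4)
      \<le> (\<Sum>A\<in>Pow J. 2 * (norm (signed_sum A J b)) ^ 4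
          + 12 * ?y * (norm (signed_sum A J b))\<^sup>2 + 2 * (norm (b x)) ^ 4)"
    using insert.hyps step by (simp add: sum_Pow_insert signed_sum_insert sum_mono)
  also have "\<dots> = 2 * (\<Sum>A\<in>Pow J. (norm (signed_sum A J b)) ^ 4)
      + 12 * ?y * (2 ^ card J * ?T) + 2 ^ card J * (2 * (norm (b x)) ^ 4)"
    using insert.hyps
    by (simp add: sum.distrib sum_distrib_left[symmetric] card_Pow signed_sum_second_moment)
  \<comment> \<open>The last coefficient grows from 2 to 6 in order to complete the square.\<close>
  also have "\<dots> \<le> 2 * (3 * 2 ^ card J * ?T\<^sup>2) + 12 * ?y * (2 ^ card J * ?T)
      + 2 ^ card J * (6 * (norm (b x)) ^ 4)"
    using insert.IH by (intro add_mono mult_left_mono) auto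
  also have "\<dots> = 3 * 2 ^ card (insert x J) * (?T + ?y)\<^sup>2"
    using insert.hyps by (simp add: power4_eq_xxxx power2_eq_square algebra_simps)
  finally show ?case using insert.hyps by (simp add: add.commute)
qed

text \<open>
  Khintchine's inequality for the first moment, obtained from the second and fourth ones through
  \<open>t \<ge> 3/4 t\<^sup>2 - 1/16 t\<^sup>4\<close>, that is \<open>(t - 2)\<^sup>2 (t + 4) \<ge> 0\<close>.
\<close>

lemma Khintchine_lower:
  fixes b :: "'i \<Rightarrow> 'a::real_inner"
  assumes "finite J"
  shows "2 ^ card J * (9 / 16 * sqrt (\<Sum>j\<in>J. (norm (b j))\<^sup>2)) \<le> (\<Sum>A\<in>Pow J. norm (signed_sum A J b))"
proof (cases "(\<Sum>j\<in>J. (norm (b j))\<^sup>2) = 0")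
  case True
  then show ?thesis by (simp add: sum_nonneg)
next
  case False
  define s where "s = sqrt (\<Sum>j\<in>J. (norm (b j))\<^sup>2)"
  have s: "s > 0" and s2: "(\<Sum>j\<in>J. (norm (b j))\<^sup>2) = s\<^sup>2"
    using False by (simp_all add: s_def sum_nonneg less_le)
  have quartic: "3 / 4 * t\<^sup>2 - 1 / 16 * t ^ 4 \<le> t" if "t \<ge> 0" for t :: real
  proof -
    have "0 \<le> t * ((t - 2)\<^sup>2 * (t + 4))" using that by simp
    also have "\<dots> = 16 * (t - (3 / 4 * t\<^sup>2 - 1 / 16 * t ^ 4))" by algebra
    finally show ?thesis by simp
  qed
  let ?n = "\<lambda>A. norm (signed_sum A J b)"
  \<comment> \<open>The quartic bound is applied to \<open>t = ?n A / s\<close>, whose second moment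
    is 1 and fourth moment at most 3; hence 3/4 - 3/16 = 9/16.\<close>
  have "2 ^ card J * (9 / 16 * s) = 3 / 4 * (2 ^ card J * s\<^sup>2) / s - 1 / 16 * (3 * 2 ^ card J * (s\<^sup>2)\<^sup>2) / s ^ 3"
    using s by (simp add: field_simps power2_eq_square power3_eq_cube)
  also have "\<dots> \<le> 3 / 4 * (\<Sum>A\<in>Pow J. (?n A)\<^sup>2) / s - 1 / 16 * (\<Sum>A\<in>Pow J. (?n A) ^ 4) / s ^ 3"
    using signed_sum_second_moment[OF assms, of b] signed_sum_fourth_moment[OF assms, of b] s
    unfolding s2 by (intro diff_mono divide_right_mono mult_left_mono) auto
  also have "\<dots> = (\<Sum>A\<in>Pow J. 3 / 4 * (?n A)\<^sup>2 / s - 1 / 16 * (?n A) ^ 4 / s ^ 3)"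
    by (simp only: sum_subtractf sum_distrib_left sum_divide_distrib)
  also have "\<dots> = (\<Sum>A\<in>Pow J. s * (3 / 4 * (?n A / s)\<^sup>2 - 1 / 16 * (?n A / s) ^ 4))"
    using s by (intro sum.cong) (simp_all add: field_simps power2_eq_square power3_eq_cube power4_eq_xxxx)
  also have "\<dots> \<le> (\<Sum>A\<in>Pow J. s * (?n A / s))"
    using s by (intro sum_mono mult_left_mono quartic) auto
  finally show ?thesis using s by (simp add: s_def)
qed

section \<open>Supports, optimal covers and partitions\<close>

text \<open>The complement is a union of open null sets, and the Lindelof property makes that union
  countable.\<close>

lemma Compl_measure_support_null:
  fixes \<mu> :: "'a::second_countable_topology measure"
  assumes "sets \<mu> = sets borel"
  shows "- measure_support \<mu> \<in> null_sets \<mu>"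
proof -
  let ?\<F> = "{U. open U \<and> emeasure \<mu> U = 0}"
  obtain \<F>' where \<F>': "\<F>' \<subseteq> ?\<F>" "countable \<F>'" "\<Union>\<F>' = \<Union>?\<F>"
    by (rule Lindelof[of ?\<F>]) auto
  have "- measure_support \<mu> = \<Union>?\<F>"
    by (auto simp: measure_support_def)
  also have "\<dots> = (\<Union>U\<in>\<F>'. U)" using \<F>' by simp
  also have "\<dots> \<in> null_sets \<mu>"
    using \<F>' by (intro null_sets_UN') (auto simp: null_sets_def assms)
  finally show ?thesis .
qed

text \<open>An infimum of naturals is attained once the set is non-empty. Compactness supplies a
  finite cover by balls of radius \<delta>/2, whose diameter is exactly \<delta>, as the definition
  demands.\<close>

lemma covering_number_attained:
  fixes X :: "'a::euclidean_space set"
  assumes "compact X" "\<delta> > 0"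
  obtains \<U> where "finite \<U>" "card \<U> = covering_number \<delta> X" "X \<subseteq> \<Union>\<U>"
    "\<And>U. U \<in> \<U> \<Longrightarrow> bounded U \<and> diameter U = \<delta>"
proof -
  let ?S = "{card \<U> | \<U>. finite \<U> \<and> (\<forall>U\<in>\<U>. bounded U \<and> diameter U = \<delta>) \<and> X \<subseteq> \<Union>\<U>}"
  have "X \<subseteq> (\<Union>x\<in>X. ball x (\<delta> / 2))" using assms by auto
  then obtain T where T: "finite T" "X \<subseteq> (\<Union>x\<in>T. ball x (\<delta> / 2))"
    by (rule compactE_image[OF assms(1), of X "\<lambda>x. ball x (\<delta> / 2)", rotated]) auto
  let ?\<V> = "(\<lambda>x. cball x (\<delta> / 2)) ` T"
  have "X \<subseteq> \<Union>?\<V>"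
    using T(2) ball_subset_cball by blast
  moreover have "bounded U \<and> diameter U = \<delta>" if "U \<in> ?\<V>" for U
    using that assms(2) by auto
  ultimately have "card ?\<V> \<in> ?S"
    using T(1) by blast
  then have "covering_number \<delta> X \<in> ?S"
    unfolding covering_number_def using Inf_nat_def1[of ?S] by blast
  then obtain \<U> where "covering_number \<delta> X = card \<U>" "finite \<U>"
    "\<forall>U\<in>\<U>. bounded U \<and> diameter U = \<delta>" "X \<subseteq> \<Union>\<U>"
    unfolding mem_Collect_eq by blast
  then show ?thesis by (intro that[of \<U>]) simp_all
qed

text \<open>The sets of an optimal cover may overlap and fail to be Borel. Closing them keeps the
  diameter and gives Borel sets; making them disjoint only shrinks them.\<close>

lemma covering_number_partition:
  fixes X :: "'a::euclidean_space set"
  assumes "compact X" "\<delta> > 0"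
  obtains Q :: "nat \<Rightarrow> 'a set" where "disjoint_family Q" "\<And>j. Q j \<in> sets borel"
    "\<And>j x y. x \<in> Q j \<Longrightarrow> y \<in> Q j \<Longrightarrow> dist x y \<le> \<delta>"
    "X \<subseteq> (\<Union>j<covering_number \<delta> X. Q j)"
proof -
  obtain \<U> where \<U>: "finite \<U>" "card \<U> = covering_number \<delta> X" "X \<subseteq> \<Union>\<U>"
    "\<And>U. U \<in> \<U> \<Longrightarrow> bounded U \<and> diameter U = \<delta>"
    using covering_number_attained[OF assms] by metis
  let ?N = "covering_number \<delta> X"
  obtain h where h: "bij_betw h {0..<?N} \<U>"
    using ex_bij_betw_nat_finite[OF \<U>(1)] \<U>(2) by auto
  \<comment> \<open>Empty sets fill the indices from \<open>?N\<close> on, so measurability and the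
    diameter bound hold for every \<open>j\<close>.\<close>
  define V where "V j = (if j < ?N then closure (h j) else {})" for j
  have "X \<subseteq> (\<Union>j\<in>{0..<?N}. V j)"
  proof
    fix x assume "x \<in> X"
    then obtain U where "U \<in> \<U>" "x \<in> U" using \<U>(3) by auto
    then obtain j where "j < ?N" "h j = U"
      using h by (auto simp: bij_betw_def)
    then show "x \<in> (\<Union>j\<in>{0..<?N}. V j)"
      using \<open>x \<in> U\<close> closure_subset by (force simp: V_def)
  qed
  moreover have "dist x y \<le> \<delta>" if "x \<in> disjointed V j" "y \<in> disjointed V j" for x y j
  proof -
    have V: "x \<in> V j" "y \<in> V j" using that disjointed_subset[of V j] by auto
    have "j < ?N" using V by (auto simp: V_def split: if_splits)
    then have "bounded (h j)" "diameter (h j) = \<delta>"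
      using h \<U>(4) by (auto simp: bij_betw_def)
    then show ?thesis
      using diameter_bounded_bound[of "closure (h j)" x y] V \<open>j < ?N\<close>
      by (simp add: V_def diameter_closure bounded_closure)
  qed
  moreover have "disjointed V j \<in> sets borel" for j
    unfolding disjointed_def by (intro sets.Diff sets.finite_UN) (auto simp: V_def)
  moreover have "(\<Union>j<?N. disjointed V j) = (\<Union>j\<in>{0..<?N}. V j)"
    using finite_UN_disjointed_eq[of V ?N] by (simp add: lessThan_atLeast0)
  ultimately show ?thesis
    by (intro that[of "disjointed V"] disjoint_family_disjointed) simp_all
qed

section \<open>Fourier transforms of the pieces\<close>

lemma norm_exp_imaginary_diff_le: "norm (exp (\<i> * of_real a) - exp (\<i> * of_real b)) \<le> \<bar>a - b\<bar>"
proof -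
  have "exp (\<i> * of_real a) - exp (\<i> * of_real b)
      = exp (\<i> * of_real b) * (exp (\<i> * of_real (a - b)) - 1)"
    by (simp add: algebra_simps flip: exp_add)
  then have "norm (exp (\<i> * of_real a) - exp (\<i> * of_real b)) = 2 * \<bar>sin ((a - b) / 2)\<bar>"
    by (simp only: norm_mult norm_exp_i_times dist_exp_i_1)
  also have "\<dots> \<le> \<bar>a - b\<bar>" using abs_sin_x_le_abs_x[of "(a - b) / 2"] by simp
  finally show ?thesis .
qed

text \<open>The phase is frozen at a point \<open>y\<close> of \<open>Q\<close>. On \<open>Q\<close>
  it moves by at most 2 \<pi> \<delta> |\<xi>| \<le> 1/2, so the transform is within \<mu>(Q)/2 of a
  number of modulus \<mu>(Q).\<close>

lemma fourier_density_indicator_lower: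
  fixes \<mu> :: "'a::euclidean_space measure"
  assumes \<mu>: "sets \<mu> = sets borel" "finite_measure \<mu>"
    and Q: "Q \<in> sets borel" "\<And>x y. x \<in> Q \<Longrightarrow> y \<in> Q \<Longrightarrow> dist x y \<le> \<delta>"
    and \<xi>: "\<delta> > 0" "norm \<xi> \<le> 1 / (4 * pi * \<delta>)"
  shows "measure \<mu> Q / 2 \<le> norm (fourier_density (indicator Q) \<mu> \<xi>)"
proof (cases "Q = {}")
  case True
  then show ?thesis by simp
next
  case False
  then obtain y where y: "y \<in> Q" by auto
  interpret finite_measure \<mu> by fact
  define e where "e x = exp (- 2 * complex_of_real pi * \<i> * complex_of_real (x \<bullet> \<xi>))" for x
  have e_alt: "e x = exp (\<i> * of_real (- 2 * pi * (x \<bullet> \<xi>)))" for x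
    by (simp add: e_def mult_ac)
  have e_norm: "norm (e x) = 1" for x
    unfolding e_alt by (rule norm_exp_i_times)
  have [measurable]: "Q \<in> sets \<mu>" "e \<in> borel_measurable \<mu>"
    using Q(1) unfolding measurable_cong_sets[OF \<mu>(1) refl] \<mu>(1) e_def by measurable
  have e_diff: "norm (e x - e y) \<le> 1 / 2" if "x \<in> Q" for x
  proof -
    have "norm (e x - e y) \<le> \<bar>- 2 * pi * (x \<bullet> \<xi>) - - 2 * pi * (y \<bullet> \<xi>)\<bar>"
      unfolding e_alt by (rule norm_exp_imaginary_diff_le)
    also have "\<dots> = 2 * pi * \<bar>(x - y) \<bullet> \<xi>\<bar>"
      by (simp add: inner_diff_left abs_mult flip: right_diff_distrib)
    also have "\<dots> \<le> 2 * pi * (norm (x - y) * norm \<xi>)"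
      by (intro mult_left_mono Cauchy_Schwarz_ineq2) auto
    also have "\<dots> \<le> 2 * pi * (\<delta> * (1 / (4 * pi * \<delta>)))"
      using Q(2)[OF that y] \<xi> by (intro mult_left_mono mult_mono) (auto simp: dist_norm)
    also have "\<dots> = 1 / 2" using \<xi> by simp
    finally show ?thesis .
  qed
  have int: "integrable \<mu> (\<lambda>x. indicator Q x * e x)"
    by (rule integrable_const_bound[where B = 1]) (auto simp: norm_mult e_norm indicator_def)
  have int_Q: "integrable \<mu> (\<lambda>x. indicator Q x :: complex)" "integrable \<mu> (\<lambda>x. indicator Q x :: real)"
    by (rule integrable_const_bound[where B = 1]; auto simp: indicator_def)+
  have int_val: "integral\<^sup>L \<mu> (indicator Q) = complex_of_real (measure \<mu> Q)"
    using integral_complex_of_real[of \<mu> "indicator Q"] by (simp add: of_real_indicator)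
  have "norm ((\<integral>x. indicator Q x * e x \<partial>\<mu>) - of_real (measure \<mu> Q) * e y)
      = norm (\<integral>x. indicator Q x * e x - indicator Q x * e y \<partial>\<mu>)"
    using int int_Q(1) by (subst Bochner_Integration.integral_diff) (simp_all add: int_val)
  also have "\<dots> \<le> (\<integral>x. indicator Q x * (1 / 2) \<partial>\<mu>)"
  proof (rule Bochner_Integration.integral_norm_bound_integral)
    show "integrable \<mu> (\<lambda>x. indicator Q x * e x - indicator Q x * e y)"
      using int int_Q(1) by simp
    show "integrable \<mu> (\<lambda>x. indicator Q x * (1 / 2 :: real))"
      using int_Q(2) by simp
    show "norm (indicator Q x * e x - indicator Q x * e y) \<le> indicator Q x * (1 / 2)" for x
      using e_diff[of x] by (simp add: indicator_def)
  qed
  also have "\<dots> = measure \<mu> Q / 2" by simp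
  finally have "norm ((\<integral>x. indicator Q x * e x \<partial>\<mu>) - of_real (measure \<mu> Q) * e y) \<le> measure \<mu> Q / 2" .
  moreover have "norm (of_real (measure \<mu> Q) * e y) = measure \<mu> Q"
    by (simp add: norm_mult e_norm)
  moreover have "norm (of_real (measure \<mu> Q) * e y) - norm (\<integral>x. indicator Q x * e x \<partial>\<mu>)
      \<le> norm ((\<integral>x. indicator Q x * e x \<partial>\<mu>) - of_real (measure \<mu> Q) * e y)"
    by (metis norm_minus_commute norm_triangle_ineq2)
  ultimately show ?thesis
    unfolding fourier_density_def e_def[symmetric] by linarith
qed

text \<open>Linearity turns the transform at a fixed \<xi> into a signed sum of fixed complex
  numbers, the form to which Khintchine applies.\<close>

lemma fourier_density_signed_sum:
  fixes \<mu> :: "'a::euclidean_space measure"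
  assumes \<mu>: "sets \<mu> = sets borel" "finite_measure \<mu>" and Q: "\<And>j. Q j \<in> sets borel"
  shows "fourier_density (\<lambda>x. signed_sum A J (\<lambda>j. indicator (Q j) x)) \<mu> \<xi>
    = signed_sum A J (\<lambda>j. fourier_density (indicator (Q j)) \<mu> \<xi>)"
proof -
  interpret finite_measure \<mu> by fact
  define e where "e x = exp (- 2 * complex_of_real pi * \<i> * complex_of_real (x \<bullet> \<xi>))" for x
  have e_norm: "norm (e x) = 1" for x
    by (simp add: e_def)
  have [measurable]: "Q j \<in> sets \<mu>" "e \<in> borel_measurable \<mu>" for j
    using Q unfolding measurable_cong_sets[OF \<mu>(1) refl] \<mu>(1) e_def by measurable
  have int: "integrable \<mu> (\<lambda>x. indicator (Q j) x * e x)" for j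
    by (rule integrable_const_bound[where B = 1]) (auto simp: norm_mult e_norm indicator_def)
  have "(\<integral>x. signed_sum A J (\<lambda>j. indicator (Q j) x) * e x \<partial>\<mu>)
      = (\<integral>x. (\<Sum>j\<in>J. (if j \<in> A then 1 else - 1) * (indicator (Q j) x * e x)) \<partial>\<mu>)"
    unfolding signed_sum_def sum_distrib_right by (intro Bochner_Integration.integral_cong refl sum.cong) auto
  also have "\<dots> = (\<Sum>j\<in>J. (if j \<in> A then 1 else - 1) * (\<integral>x. indicator (Q j) x * e x \<partial>\<mu>))"
    using int by (subst Bochner_Integration.integral_sum) auto
  also have "\<dots> = signed_sum A J (\<lambda>j. \<integral>x. indicator (Q j) x * e x \<partial>\<mu>)"
    unfolding signed_sum_def by (intro sum.cong) auto
  finally show ?thesis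
    unfolding fourier_density_def e_def .
qed

lemma borel_measurable_fourier_density:
  fixes \<mu> :: "'a::euclidean_space measure"
  assumes \<mu>: "sets \<mu> = sets borel" "finite_measure \<mu>" and f: "f \<in> borel_measurable \<mu>"
  shows "fourier_density f \<mu> \<in> borel_measurable borel"
proof -
  interpret finite_measure \<mu> by fact
  have [measurable]: "f \<in> borel_measurable borel"
    using f unfolding measurable_cong_sets[OF \<mu>(1) refl] .
  show ?thesis
    unfolding fourier_density_def
  proof (rule borel_measurable_lebesgue_integral)
    have "(\<lambda>(\<xi>, x). f x * exp (- 2 * complex_of_real pi * \<i> * complex_of_real (x \<bullet> \<xi>)))
        \<in> borel_measurable (borel \<Otimes>\<^sub>M borel)"
      by measurable
    then show "(\<lambda>(\<xi>, x). f x * exp (- 2 * complex_of_real pi * \<i> * complex_of_real (x \<bullet> \<xi>)))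
        \<in> borel_measurable (borel \<Otimes>\<^sub>M \<mu>)"
      using measurable_cong_sets[OF sets_pair_measure_cong[OF refl \<mu>(1)] refl] by blast
  qed
qed

section \<open>Bounds for Lebesgue norms\<close>

text \<open>By disjointness at most one term is non-zero at each point.\<close>

lemma norm_signed_sum_indicator_le:
  assumes "disjoint_family Q" "finite J"
  shows "norm (signed_sum A J (\<lambda>j. indicator (Q j) x :: complex)) \<le> 1"
proof -
  have "norm (signed_sum A J (\<lambda>j. indicator (Q j) x :: complex)) \<le> (\<Sum>j\<in>J. indicator (Q j) x)"
    unfolding signed_sum_def by (intro sum_norm_le) (auto simp: indicator_def)
  also have "\<dots> = indicator (\<Union>j\<in>J. Q j) x"
    using assms by (intro indicator_UN_disjoint[symmetric]) (auto simp: disjoint_family_on_def)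
  also have "\<dots> \<le> (1 :: real)" by (simp add: indicator_def)
  finally show ?thesis .
qed

text \<open>This controls the right-hand side of the estimate independently of \<delta> and of the
  signs. For finite exponents the total mass is raised to a power 1/r \<le> 1, so its maximum with 1
  is a bound for all \<open>p\<close>.\<close>

lemma Lp_norm_le_of_norm_le_1:
  assumes "finite_measure M" "f \<in> borel_measurable M" "\<And>x. norm (f x) \<le> 1" "1 \<le> p"
  shows "Lp_norm p M f \<le> ennreal (max 1 (measure M (space M)))"
proof (cases "p = \<infinity>")
  case True
  have "esssup M (\<lambda>x. ennreal (norm (f x))) \<le> 1"
    using assms by (intro esssup_I) auto
  also have "1 \<le> ennreal (max 1 (measure M (space M)))"
    by (metis ennreal_1 ennreal_leI max.cobounded1)
  finally show ?thesis by (simp add: Lp_norm_def True)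
next
  case False
  interpret finite_measure M by fact
  obtain r where r: "p = ereal r" "1 \<le> r"
    using False assms(4) by (cases p) auto
  define I where "I = (\<integral>\<^sup>+x. ennreal (norm (f x) powr r) \<partial>M)"
  have "I \<le> (\<integral>\<^sup>+x. 1 \<partial>M)"
    unfolding I_def using assms(3) r by (intro nn_integral_mono) (simp add: powr_le1)
  then have I: "I \<le> ennreal (measure M (space M))"
    by (simp add: emeasure_eq_measure)
  let ?m = "max 1 (measure M (space M))"
  have "enn2real I \<le> measure M (space M)"
    using I by (simp add: enn2real_leI)
  then have "enn2real I powr (1 / r) \<le> ?m powr (1 / r)"
    using r by (intro powr_mono2) auto
  also have "\<dots> \<le> ?m powr 1"
    using r by (intro powr_mono) auto
  finally have "enn2real I powr (1 / r) \<le> ?m" by simp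
  moreover have "I \<noteq> \<infinity>" using I by (auto simp: top_unique)
  ultimately show ?thesis
    using r by (simp add: Lp_norm_def I_def[symmetric] Let_def ennreal_leI)
qed

text \<open>
  A substitute for Hoelder's inequality on \<open>B\<close>: pointwise, \<open>t \<le> c + c\<^sup>1\<^sup>-\<^sup>r t\<^sup>r\<close>.
\<close>

lemma Lp_norm_ge_of_set_nn_integral:
  assumes B: "B \<in> sets M" "emeasure M B = ennreal b" "0 \<le> b"
    and f: "f \<in> borel_measurable M" and c: "0 < c" and r: "1 \<le> r"
    and large: "ennreal (2 * c * b) \<le> (\<integral>\<^sup>+x\<in>B. ennreal (norm (f x)) \<partial>M)"
  shows "ennreal (c * b powr (1 / r)) \<le> Lp_norm (ereal r) M f"
proof -
  define I where "I = (\<integral>\<^sup>+x. ennreal (norm (f x) powr r) \<partial>M)"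
  show ?thesis
  proof (cases "I = \<infinity>")
    case True
    then show ?thesis by (simp add: Lp_norm_def I_def[symmetric])
  next
    case False
    then obtain i where i: "I = ennreal i" "0 \<le> i" by (cases I) auto
    have pointwise: "t \<le> c + c powr (1 - r) * t powr r" if "0 \<le> t" for t
    proof (cases "t \<le> c")
      case True
      then show ?thesis by (simp add: add_increasing2)
    next
      case False
      then have "t = t powr (1 - r) * t powr r"
        using c by (simp flip: powr_add)
      also have "\<dots> \<le> c powr (1 - r) * t powr r"
        using False c r by (intro mult_right_mono powr_mono2') auto
      finally show ?thesis using c by simp
    qed
    have [measurable]: "B \<in> sets M" "f \<in> borel_measurable M" by fact+
    have "ennreal (2 * c * b) \<le> (\<integral>\<^sup>+x. ennreal c * indicator B x
        + ennreal (c powr (1 - r)) * ennreal (norm (f x) powr r) \<partial>M)"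
    proof (rule order_trans[OF large nn_integral_mono])
      fix x
      show "ennreal (norm (f x)) * indicator B x
        \<le> ennreal c * indicator B x + ennreal (c powr (1 - r)) * ennreal (norm (f x) powr r)"
        using pointwise[of "norm (f x)"] c
        by (auto simp: indicator_def simp flip: ennreal_mult ennreal_plus intro!: ennreal_leI)
    qed
    also have "\<dots> = ennreal c * ennreal b + ennreal (c powr (1 - r)) * ennreal i"
      by (simp add: nn_integral_add nn_integral_cmult B I_def[symmetric] i)
    also have "\<dots> = ennreal (c * b + c powr (1 - r) * i)"
      using c i B by (simp add: ennreal_mult)
    finally have "2 * c * b \<le> c * b + c powr (1 - r) * i"
      using c i B by (subst (asm) ennreal_le_iff) auto
    \<comment> \<open>The factor 2 in \<open>large\<close> pays for the constant part
      \<open>c\<close> of the pointwise bound, whose integral over \<open>B\<close> is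
      \<open>c * b\<close>.\<close>
    then have "c * b \<le> c powr (1 - r) * i" by linarith
    then have "c powr (r - 1) * (c * b) \<le> c powr (r - 1) * (c powr (1 - r) * i)"
      by (intro mult_left_mono) auto
    also have "\<dots> = i" using c by (simp flip: mult.assoc powr_add)
    also have "c powr (r - 1) * (c * b) = c powr r * b"
      using c by (simp add: powr_diff)
    finally have "(c powr r * b) powr (1 / r) \<le> i powr (1 / r)"
      using r B by (intro powr_mono2) auto
    moreover have "(c powr r * b) powr (1 / r) = c * b powr (1 / r)"
      using c r B by (simp add: powr_mult powr_powr)
    ultimately show ?thesis
      using i by (simp add: Lp_norm_def I_def[symmetric] Let_def ennreal_leI)
  qed
qed

section \<open>Averaging over the signs\<close>

text \<open>Khintchine bounds the mean below by 9/16 of the l2 norm of the transforms of the pieces.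
  Cauchy-Schwarz compares it with the l1 norm at a loss of \<open>sqrt N\<close>, and the l1 norm is
  at least half the mass; hence 9/32.\<close>

lemma sum_norm_fourier_density_lower:
  fixes \<mu> :: "'a::euclidean_space measure"
  assumes \<mu>: "sets \<mu> = sets borel" "finite_measure \<mu>"
    and Q: "disjoint_family Q" "\<And>j. Q j \<in> sets borel"
      "\<And>j x y. x \<in> Q j \<Longrightarrow> y \<in> Q j \<Longrightarrow> dist x y \<le> \<delta>"
    and \<xi>: "\<delta> > 0" "norm \<xi> \<le> 1 / (4 * pi * \<delta>)"
  shows "2 ^ N * (9 / 32 * (measure \<mu> (\<Union>j<N. Q j) / sqrt (real N)))
    \<le> (\<Sum>A\<in>Pow {..<N}. norm (fourier_density (\<lambda>x. signed_sum A {..<N} (\<lambda>j. indicator (Q j) x)) \<mu> \<xi>))"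
proof -
  interpret finite_measure \<mu> by fact
  let ?b = "\<lambda>j. fourier_density (indicator (Q j)) \<mu> \<xi>"
  have "measure \<mu> (\<Union>j<N. Q j) = (\<Sum>j<N. measure \<mu> (Q j))"
    using Q by (intro measure_finite_Union) (auto simp: \<mu>(1) disjoint_family_on_def emeasure_eq_measure)
  also have "\<dots> \<le> (\<Sum>j<N. 2 * norm (?b j))"
    using fourier_density_indicator_lower[OF \<mu> Q(2) Q(3) \<xi>] by (intro sum_mono) (simp add: field_simps)
  finally have "(measure \<mu> (\<Union>j<N. Q j))\<^sup>2 \<le> (2 * (\<Sum>j<N. norm (?b j)))\<^sup>2"
    by (intro power_mono) (auto simp: sum_distrib_left)
  also have "\<dots> \<le> 4 * ((\<Sum>j<N. (norm (?b j))\<^sup>2) * real N)"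
    using sum_squared_le_sum_of_squares[of "\<lambda>j. norm (?b j)" "{..<N}"] by (simp add: power_mult_distrib)
  finally have "(measure \<mu> (\<Union>j<N. Q j))\<^sup>2 \<le> 4 * ((\<Sum>j<N. (norm (?b j))\<^sup>2) * real N)" .
  then have "measure \<mu> (\<Union>j<N. Q j) \<le> 2 * (sqrt (\<Sum>j<N. (norm (?b j))\<^sup>2) * sqrt (real N))"
    using real_le_rsqrt by (fastforce simp: real_sqrt_mult)
  \<comment> \<open>For \<open>N = 0\<close> the quotient is 0 by convention.\<close>
  then have "measure \<mu> (\<Union>j<N. Q j) / sqrt (real N) \<le> 2 * sqrt (\<Sum>j<N. (norm (?b j))\<^sup>2)"
    by (cases "N = 0") (auto simp: field_simps)
  then have "2 ^ N * (9 / 32 * (measure \<mu> (\<Union>j<N. Q j) / sqrt (real N)))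
      \<le> 2 ^ N * (9 / 32 * (2 * sqrt (\<Sum>j<N. (norm (?b j))\<^sup>2)))"
    by (intro mult_left_mono) auto
  also have "\<dots> = 2 ^ N * (9 / 16 * sqrt (\<Sum>j<N. (norm (?b j))\<^sup>2))"
    by simp
  also have "\<dots> \<le> (\<Sum>A\<in>Pow {..<N}. norm (signed_sum A {..<N} ?b))"
    using Khintchine_lower[of "{..<N}" ?b] by simp
  finally show ?thesis
    by (simp only: fourier_density_signed_sum[OF \<mu> Q(2)])
qed

text \<open>The signs must not depend on \<xi>, so the averaged lower bound is first integrated over
  \<open>B\<close>; some joint choice of signs then does at least as well as the mean.\<close>

lemma exists_signs_integral_ge:
  fixes \<mu> :: "'i \<Rightarrow> 'a::euclidean_space measure"
    and Q :: "'i \<Rightarrow> nat \<Rightarrow> 'a set" and N :: "'i \<Rightarrow> nat"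
  assumes I: "finite I"
    and \<mu>: "\<And>m. m \<in> I \<Longrightarrow> sets (\<mu> m) = sets borel" "\<And>m. m \<in> I \<Longrightarrow> finite_measure (\<mu> m)"
    and Q: "\<And>m. m \<in> I \<Longrightarrow> disjoint_family (Q m)" "\<And>m j. m \<in> I \<Longrightarrow> Q m j \<in> sets borel"
      "\<And>m j x y. m \<in> I \<Longrightarrow> x \<in> Q m j \<Longrightarrow> y \<in> Q m j \<Longrightarrow> dist x y \<le> \<delta>"
    and \<delta>: "\<delta> > 0"
  defines "f \<equiv> \<lambda>A m x. signed_sum (A m) {..<N m} (\<lambda>j. indicator (Q m j) x :: complex)"
    and "B \<equiv> cball 0 (1 / (4 * pi * \<delta>))"
  obtains A where "emeasure lborel B * ennreal (\<Prod>m\<in>I. 9 / 32 * (measure (\<mu> m) (\<Union>j<N m. Q m j) / sqrt (real (N m))))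
    \<le> (\<integral>\<^sup>+\<xi>\<in>B. ennreal (norm (\<Prod>m\<in>I. fourier_density (f A m) (\<mu> m) \<xi>)) \<partial>lborel)"
proof -
  define S where "S = PiE I (\<lambda>m. Pow {..<N m})"
  define L where "L A = (\<integral>\<^sup>+\<xi>\<in>B. ennreal (norm (\<Prod>m\<in>I. fourier_density (f A m) (\<mu> m) \<xi>)) \<partial>lborel)" for A
  define a where "a m = 9 / 32 * (measure (\<mu> m) (\<Union>j<N m. Q m j) / sqrt (real (N m)))" for m
  have S: "finite S" "S \<noteq> {}" "real (card S) = (\<Prod>m\<in>I. 2 ^ N m)"
    using I by (auto simp: S_def card_PiE card_Pow PiE_eq_empty_iff intro!: finite_PiE)
  have meas: "(\<lambda>\<xi>. fourier_density (f A m) (\<mu> m) \<xi>) \<in> borel_measurable borel" if "m \<in> I" for A m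
  proof (rule borel_measurable_fourier_density[OF \<mu>[OF that]])
    show "f A m \<in> borel_measurable (\<mu> m)"
      unfolding f_def signed_sum_def measurable_cong_sets[OF \<mu>(1)[OF that] refl]
      using Q(2)[OF that] by measurable
  qed
  have meas_prod: "(\<lambda>\<xi>. ennreal (norm (\<Prod>m\<in>I. fourier_density (f A m) (\<mu> m) \<xi>)) * indicator B \<xi>)
      \<in> borel_measurable lborel" for A
  proof -
    have [measurable]: "B \<in> sets borel" by (simp add: B_def)
    show ?thesis using meas by measurable
  qed
  have pointwise: "ennreal (real (card S)) * ennreal (\<Prod>m\<in>I. a m) * indicator B \<xi>
      \<le> (\<Sum>A\<in>S. ennreal (norm (\<Prod>m\<in>I. fourier_density (f A m) (\<mu> m) \<xi>)) * indicator B \<xi>)" for \<xi>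
  proof (cases "\<xi> \<in> B")
    case True
    have "real (card S) * (\<Prod>m\<in>I. a m) = (\<Prod>m\<in>I. 2 ^ N m * a m)"
      by (simp add: S prod.distrib)
    also have "\<dots> \<le> (\<Prod>m\<in>I. \<Sum>A\<in>Pow {..<N m}. norm (fourier_density (\<lambda>x. signed_sum A {..<N m} (\<lambda>j. indicator (Q m j) x)) (\<mu> m) \<xi>))"
      using True \<delta> \<mu> Q unfolding a_def B_def
      by (intro prod_mono conjI sum_norm_fourier_density_lower[where \<delta> = \<delta>]) (auto intro!: mult_nonneg_nonneg)
    \<comment> \<open>Independence of the signs for different \<open>m\<close>: expanding the
      product of sums gives one sum over joint choices.\<close>
    also have "\<dots> = (\<Sum>A\<in>S. norm (\<Prod>m\<in>I. fourier_density (f A m) (\<mu> m) \<xi>))"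
      using I by (subst prod_sum_PiE) (auto simp: S_def f_def prod_norm)
    finally show ?thesis
      using True by (simp add: sum_nonneg prod_nonneg a_def flip: ennreal_mult)
  qed simp
  have "ennreal (real (card S)) * (emeasure lborel B * ennreal (\<Prod>m\<in>I. a m))
      = (\<integral>\<^sup>+\<xi>. ennreal (real (card S)) * ennreal (\<Prod>m\<in>I. a m) * indicator B \<xi> \<partial>lborel)"
    by (subst nn_integral_cmult_indicator) (auto simp: B_def mult_ac)
  also have "\<dots> \<le> (\<integral>\<^sup>+\<xi>. (\<Sum>A\<in>S. ennreal (norm (\<Prod>m\<in>I. fourier_density (f A m) (\<mu> m) \<xi>)) * indicator B \<xi>) \<partial>lborel)"
    by (intro nn_integral_mono pointwise)
  also have "\<dots> = (\<Sum>A\<in>S. L A)"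
    unfolding L_def by (intro nn_integral_sum meas_prod)
  also have "\<dots> \<le> of_nat (card S) * Max (L ` S)"
    using S by (intro sum_bounded_above) auto
  finally have "emeasure lborel B * ennreal (\<Prod>m\<in>I. a m) \<le> Max (L ` S)"
    using S(1,2) by (simp add: ennreal_of_nat_eq_real_of_nat ennreal_mult_le_mult_iff)
  moreover have "Max (L ` S) \<in> L ` S"
    using S by (intro Max_in) auto
  then obtain A where "L A = Max (L ` S)" by (metis imageE)
  ultimately show ?thesis
    using that[of A] by (simp add: a_def L_def)
qed

section \<open>From covering numbers to box dimensions\<close>

text \<open>After taking logarithms and dividing by \<open>- ln \<delta>\<close>, the constant
  \<open>c\<close> disappears in the limit. Arguing by contradiction makes all the dimensions
  finite, so the rest is real arithmetic.\<close>

lemma sum_upper_box_dim_ge: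
  fixes X :: "'i \<Rightarrow> 'a::metric_space set"
  assumes I: "finite I" and c: "c > 0"
    and pos: "\<And>m \<delta>. m \<in> I \<Longrightarrow> \<delta> > 0 \<Longrightarrow> covering_number \<delta> (X m) \<ge> 1"
    and lower: "\<And>\<delta>. \<delta> > 0 \<Longrightarrow> c * \<delta> powr (- s) \<le> (\<Prod>m\<in>I. real (covering_number \<delta> (X m)))"
  shows "ereal s \<le> (\<Sum>m\<in>I. upper_box_dim (X m))"
proof (rule ccontr)
  assume "\<not> ereal s \<le> (\<Sum>m\<in>I. upper_box_dim (X m))"
  then have less: "(\<Sum>m\<in>I. upper_box_dim (X m)) < ereal s" by simp
  define g where "g m \<delta> = ln (real (covering_number \<delta> (X m))) / (- ln \<delta>)" for m \<delta>
  have small: "\<forall>\<^sub>F \<delta>::real in at_right 0. 0 < \<delta> \<and> \<delta> < 1"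
    using eventually_at_right_real[of 0 1] by (auto elim: eventually_mono)
  \<comment> \<open>Covering numbers at least 1 exclude negative values, and the assumed bound on
    the sum excludes \<infinity>.\<close>
  have "\<exists>d. upper_box_dim (X m) = ereal d" if "m \<in> I" for m
  proof -
    have "\<forall>\<^sub>F \<delta> in at_right 0. 0 \<le> ereal (g m \<delta>)"
      using small
    proof eventually_elim
      case (elim \<delta>)
      then have "ln (real (covering_number \<delta> (X m))) \<ge> 0" "- ln \<delta> > 0"
        using pos[OF that, of \<delta>] by auto
      then show ?case by (simp only: g_def ereal_less_eq divide_nonneg_pos zero_ereal_def)
    qed
    then have "0 \<le> upper_box_dim (X m)"
      unfolding upper_box_dim_def g_def by (intro le_Limsup) auto
    moreover have "upper_box_dim (X m) \<noteq> \<infinity>"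
      using less I that sum_Pinfty[of "\<lambda>m. upper_box_dim (X m)" I] by auto
    ultimately show ?thesis by (cases "upper_box_dim (X m)") auto
  qed
  then obtain d where d: "\<And>m. m \<in> I \<Longrightarrow> upper_box_dim (X m) = ereal (d m)" by metis
  \<comment> \<open>The gap is split into \<open>card I\<close> shares for the dimensions and one
    for the term with \<open>ln c\<close>.\<close>
  define \<epsilon> where "\<epsilon> = (s - (\<Sum>m\<in>I. d m)) / (real (card I) + 1)"
  have "(\<Sum>m\<in>I. d m) < s" using less d by simp
  then have \<epsilon>: "\<epsilon> > 0" by (simp add: \<epsilon>_def)
  have "\<forall>\<^sub>F \<delta> in at_right 0. g m \<delta> < d m + \<epsilon>" if "m \<in> I" for m
  proof -
    have "Limsup (at_right 0) (\<lambda>\<delta>. ereal (g m \<delta>)) < ereal (d m + \<epsilon>)"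
      using d[OF that] \<epsilon> by (simp add: upper_box_dim_def g_def)
    from Limsup_lessD[OF this] show ?thesis by simp
  qed
  then have "\<forall>\<^sub>F \<delta> in at_right 0. \<forall>m\<in>I. g m \<delta> < d m + \<epsilon>"
    using I by (simp add: eventually_ball_finite)
  moreover have "((\<lambda>\<delta>. ln c / (- ln \<delta>)) \<longlongrightarrow> 0) (at_right 0)"
    by real_asymp
  then have "\<forall>\<^sub>F \<delta> in at_right 0. - \<epsilon> < ln c / (- ln \<delta>)"
    using \<epsilon> by (intro order_tendstoD) auto
  ultimately have "\<forall>\<^sub>F \<delta>::real in at_right 0. False"
    using small
  proof eventually_elim
    case (elim \<delta>)
    have "ln c - s * ln \<delta> = ln (c * \<delta> powr (- s))"
      using c elim by (simp add: ln_mult)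
    also have "\<dots> \<le> ln (\<Prod>m\<in>I. real (covering_number \<delta> (X m)))"
      using lower[of \<delta>] c elim by (intro ln_mono) auto
    also have "\<dots> = (\<Sum>m\<in>I. ln (real (covering_number \<delta> (X m))))"
      using I pos elim by (intro ln_prod) (auto simp: Suc_le_eq)
    finally have "(ln c - s * ln \<delta>) / (- ln \<delta>) \<le> (\<Sum>m\<in>I. g m \<delta>)"
      using elim unfolding g_def sum_divide_distrib[symmetric] by (intro divide_right_mono) auto
    also have "(\<Sum>m\<in>I. g m \<delta>) \<le> (\<Sum>m\<in>I. d m + \<epsilon>)"
      using elim by (intro sum_mono) (auto intro: less_imp_le)
    also have "\<dots> = (\<Sum>m\<in>I. d m) + (real (card I) + 1) * \<epsilon> - \<epsilon>"
      by (simp add: sum.distrib algebra_simps)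
    also have "\<dots> = s - \<epsilon>" unfolding \<epsilon>_def by simp
    \<comment> \<open>The chain now reads
      \<open>ln c / (- ln \<delta>) + s \<le> s - \<epsilon>\<close>, against the choice of
      \<delta>.\<close>
    also have "(ln c - s * ln \<delta>) / (- ln \<delta>) = ln c / (- ln \<delta>) + s"
      using elim by (simp add: field_simps)
    finally show False using elim by simp
  qed
  then show False by simp
qed

section \<open>Testing the estimate and conclusion\<close>

lemma measure_cover_support:
  fixes \<mu> :: "'a::second_countable_topology measure"
  assumes \<mu>: "sets \<mu> = sets borel" "finite_measure \<mu>"
    and U: "U \<in> sets borel" "measure_support \<mu> \<subseteq> U"
  shows "measure \<mu> U = measure \<mu> UNIV"
proof (rule measure_eq_AE)
  have "AE x in \<mu>. x \<notin> - measure_support \<mu>"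
    by (rule AE_not_in[OF Compl_measure_support_null[OF \<mu>(1)]])
  then show "AE x in \<mu>. x \<in> U \<longleftrightarrow> x \<in> UNIV"
    by eventually_elim (use U(2) in auto)
qed (use U \<mu> in auto)

text \<open>The estimate is tested on well-chosen sign functions. With \<open>P\<close> the product
  of the covering numbers, its left side is at least of order \<delta>^(-d/r) / sqrt P and its right
  side at most \<open>C * K\<close>; squaring gives the bound on \<open>P\<close>.\<close>

lemma prod_covering_number_ge:
  fixes \<mu> :: "'i \<Rightarrow> 'a::euclidean_space measure"
  assumes I: "finite I"
    and \<mu>: "\<And>m. m \<in> I \<Longrightarrow> sets (\<mu> m) = sets borel" "\<And>m. m \<in> I \<Longrightarrow> finite_measure (\<mu> m)"
      "\<And>m. m \<in> I \<Longrightarrow> emeasure (\<mu> m) UNIV \<noteq> 0" "\<And>m. m \<in> I \<Longrightarrow> compact (measure_support (\<mu> m))"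
    and p: "1 \<le> p" and r: "1 \<le> r" and C: "0 < C"
    and est: "\<And>f. (\<And>m. m \<in> I \<Longrightarrow> f m \<in> Lp_space p (\<mu> m)) \<Longrightarrow>
      Lp_norm (ereal r) lborel (\<lambda>\<xi>. \<Prod>m\<in>I. fourier_density (f m) (\<mu> m) \<xi>)
        \<le> ennreal C * (\<Prod>m\<in>I. Lp_norm p (\<mu> m) (f m))"
  obtains c where "c > 0"
    "\<And>m \<delta>. m \<in> I \<Longrightarrow> \<delta> > 0 \<Longrightarrow> covering_number \<delta> (measure_support (\<mu> m)) \<ge> 1"
    "\<And>\<delta>. \<delta> > 0 \<Longrightarrow> c * \<delta> powr (- (2 * real DIM('a) / r))
      \<le> (\<Prod>m\<in>I. real (covering_number \<delta> (measure_support (\<mu> m))))"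
proof -
  define N where "N \<delta> m = covering_number \<delta> (measure_support (\<mu> m))" for \<delta> m
  define M where "M m = measure (\<mu> m) UNIV" for m
  have M: "M m > 0" if "m \<in> I" for m
    using \<mu>(3)[OF that] finite_measure.emeasure_eq_measure[OF \<mu>(2)[OF that]]
    by (simp add: M_def zero_less_measure_iff)
  define K where "K = (\<Prod>m\<in>I. max 1 (M m))"
  have K: "K > 0" unfolding K_def by (intro prod_pos) auto
  define a where "a = (\<Prod>m\<in>I. 9 / 32 * M m)"
  have a: "a > 0" unfolding a_def using M by (intro prod_pos) auto
  \<comment> \<open>The ball of radius 1/(4 \<pi> \<delta>) has volume
    \<open>v * \<delta> powr (- real DIM('a))\<close>.\<close>
  define v where "v = unit_ball_vol (real DIM('a)) * (1 / (4 * pi)) ^ DIM('a)"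
  have v: "v > 0" by (simp add: v_def)
  define c where "c = a / 2 * v powr (1 / r) / (C * K)"
  have c: "c > 0" using a v C K by (simp add: c_def)
  have main: "(\<forall>m\<in>I. N \<delta> m \<ge> 1) \<and> c * \<delta> powr (- (real DIM('a) / r)) \<le> sqrt (\<Prod>m\<in>I. real (N \<delta> m))"
    if \<delta>: "\<delta> > 0" for \<delta>
  proof -
    have "\<exists>Q :: nat \<Rightarrow> 'a set. disjoint_family Q \<and> (\<forall>j. Q j \<in> sets borel) \<and>
        (\<forall>j x y. x \<in> Q j \<longrightarrow> y \<in> Q j \<longrightarrow> dist x y \<le> \<delta>) \<and> measure_support (\<mu> m) \<subseteq> (\<Union>j<N \<delta> m. Q j)"
      if "m \<in> I" for m
      using covering_number_partition[OF \<mu>(4)[OF that] \<delta>] unfolding N_def by metis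
    then obtain Q :: "'i \<Rightarrow> nat \<Rightarrow> 'a set" where
      Q: "\<And>m. m \<in> I \<Longrightarrow> disjoint_family (Q m)" "\<And>m j. m \<in> I \<Longrightarrow> Q m j \<in> sets borel"
        "\<And>m j x y. m \<in> I \<Longrightarrow> x \<in> Q m j \<Longrightarrow> y \<in> Q m j \<Longrightarrow> dist x y \<le> \<delta>"
        "\<And>m. m \<in> I \<Longrightarrow> measure_support (\<mu> m) \<subseteq> (\<Union>j<N \<delta> m. Q m j)"
      by metis
    have full: "measure (\<mu> m) (\<Union>j<N \<delta> m. Q m j) = M m" if "m \<in> I" for m
      unfolding M_def using Q(2)[OF that]
      by (intro measure_cover_support \<mu>(1,2) Q(4) that) auto
    \<comment> \<open>With no pieces the union would be empty, yet it carries the positive mass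
      \<open>M m\<close>.\<close>
    have N: "N \<delta> m \<ge> 1" if "m \<in> I" for m
    proof (rule ccontr)
      assume "\<not> N \<delta> m \<ge> 1"
      then have "N \<delta> m = 0" by simp
      then show False using full[OF that] M[OF that] by simp
    qed
    define P where "P = (\<Prod>m\<in>I. real (N \<delta> m))"
    have P: "P > 0" unfolding P_def using N by (intro prod_pos) (auto simp: Suc_le_eq)
    define B :: "'a set" where "B = cball 0 (1 / (4 * pi * \<delta>))"
    define b where "b = v * \<delta> powr (- real DIM('a))"
    have b: "b > 0" using v \<delta> by (simp add: b_def)
    have B: "emeasure lborel B = ennreal b"
      using \<delta> by (simp add: B_def emeasure_cball b_def v_def powr_minus powr_realpow
          power_divide power_mult_distrib field_simps)
    have prod_eq: "(\<Prod>m\<in>I. 9 / 32 * (measure (\<mu> m) (\<Union>j<N \<delta> m. Q m j) / sqrt (real (N \<delta> m)))) = a / sqrt P"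
    proof -
      have "sqrt P = (\<Prod>m\<in>I. sqrt (real (N \<delta> m)))"
        unfolding P_def by (induction I rule: infinite_finite_induct) (auto simp: real_sqrt_mult)
      then show ?thesis
        unfolding a_def by (simp add: full flip: prod_dividef)
    qed
    obtain A where "emeasure lborel B *
        ennreal (\<Prod>m\<in>I. 9 / 32 * (measure (\<mu> m) (\<Union>j<N \<delta> m. Q m j) / sqrt (real (N \<delta> m))))
      \<le> (\<integral>\<^sup>+\<xi>\<in>B. ennreal (norm (\<Prod>m\<in>I. fourier_density
          (\<lambda>x. signed_sum (A m) {..<N \<delta> m} (\<lambda>j. indicator (Q m j) x)) (\<mu> m) \<xi>)) \<partial>lborel)"
      by (rule exists_signs_integral_ge[OF I \<mu>(1,2) Q(1-3) \<delta>, where N = "N \<delta>", folded B_def])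
    note A = this[unfolded prod_eq]
    define f where "f m x = signed_sum (A m) {..<N \<delta> m} (\<lambda>j. indicator (Q m j) x :: complex)" for m x
    have f_meas: "f m \<in> borel_measurable (\<mu> m)" if "m \<in> I" for m
      unfolding f_def signed_sum_def measurable_cong_sets[OF \<mu>(1)[OF that] refl]
      using Q(2)[OF that] by measurable
    have f_norm: "Lp_norm p (\<mu> m) (f m) \<le> ennreal (max 1 (M m))" if "m \<in> I" for m
    proof -
      have "space (\<mu> m) = UNIV" using sets_eq_imp_space_eq[OF \<mu>(1)[OF that]] by simp
      then show ?thesis
        using Lp_norm_le_of_norm_le_1[OF \<mu>(2)[OF that] f_meas[OF that] _ p]
          norm_signed_sum_indicator_le[OF Q(1)[OF that]]
        by (simp add: f_def M_def)
    qed
    have "ennreal (a / sqrt P / 2 * b powr (1 / r))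
      \<le> Lp_norm (ereal r) lborel (\<lambda>\<xi>. \<Prod>m\<in>I. fourier_density (f m) (\<mu> m) \<xi>)"
    \<comment> \<open>The threshold is half of \<open>a / sqrt P\<close>, the lower bound for the
      mean over the signs.\<close>
    proof (rule Lp_norm_ge_of_set_nn_integral[OF _ B])
      show "(\<lambda>\<xi>. \<Prod>m\<in>I. fourier_density (f m) (\<mu> m) \<xi>) \<in> borel_measurable lborel"
        using borel_measurable_fourier_density[OF \<mu>(1,2) f_meas] by measurable
      show "ennreal (2 * (a / sqrt P / 2) * b)
        \<le> (\<integral>\<^sup>+\<xi>\<in>B. ennreal (norm (\<Prod>m\<in>I. fourier_density (f m) (\<mu> m) \<xi>)) \<partial>lborel)"
        using A a b P by (simp add: B f_def[abs_def] mult.commute flip: ennreal_mult)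
    qed (use a b P r in \<open>auto simp: B_def\<close>)
    also have "\<dots> \<le> ennreal C * (\<Prod>m\<in>I. Lp_norm p (\<mu> m) (f m))"
    proof (rule est)
      show "f m \<in> Lp_space p (\<mu> m)" if "m \<in> I" for m
        using f_meas[OF that] f_norm[OF that] by (auto simp: Lp_space_def intro: le_less_trans)
    qed
    also have "\<dots> \<le> ennreal C * (\<Prod>m\<in>I. ennreal (max 1 (M m)))"
    proof (rule mult_left_mono)
      show "(\<Prod>m\<in>I. Lp_norm p (\<mu> m) (f m)) \<le> (\<Prod>m\<in>I. ennreal (max 1 (M m)))"
        using I f_norm by (induction I rule: finite_induct) (auto intro!: mult_mono)
    qed simp
    also have "\<dots> = ennreal (C * K)"
      using C K by (simp add: K_def prod_ennreal ennreal_mult)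
    finally have "a / sqrt P / 2 * b powr (1 / r) \<le> C * K"
      using C K by (subst (asm) ennreal_le_iff) auto
    moreover have "b powr (1 / r) = v powr (1 / r) * \<delta> powr (- (real DIM('a) / r))"
      using v \<delta> by (simp add: b_def powr_mult powr_powr)
    ultimately have "c * \<delta> powr (- (real DIM('a) / r)) \<le> sqrt P"
      using C K P by (simp add: c_def field_simps)
    then show ?thesis using N unfolding P_def by blast
  qed
  show ?thesis
  proof (rule that[of "c\<^sup>2"])
    show "c\<^sup>2 > 0" using c by simp
    show "covering_number \<delta> (measure_support (\<mu> m)) \<ge> 1" if "m \<in> I" "\<delta> > 0" for m \<delta>
      using main[OF that(2)] that(1) by (simp add: N_def)
    show "c\<^sup>2 * \<delta> powr (- (2 * real DIM('a) / r))
        \<le> (\<Prod>m\<in>I. real (covering_number \<delta> (measure_support (\<mu> m))))" if "\<delta> > 0" for \<delta>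
    proof -
      have "(c * \<delta> powr (- (real DIM('a) / r)))\<^sup>2 \<le> (sqrt (\<Prod>m\<in>I. real (N \<delta> m)))\<^sup>2"
        using main[OF that] c by (intro power_mono) auto
      moreover have "(c * \<delta> powr (- (real DIM('a) / r)))\<^sup>2 = c\<^sup>2 * \<delta> powr (- (2 * real DIM('a) / r))"
        by (simp add: power_mult_distrib power2_eq_square flip: powr_add)
      ultimately show ?thesis by (simp add: N_def prod_nonneg)
    qed
  qed
qed

theorem proposition3p3:
  fixes k :: nat
    and \<mu> :: "nat \<Rightarrow> (real ^ 'd) measure"
    and p q :: ereal
  assumes "2 \<le> k"
    and "\<And>m. m \<in> {1..k} \<Longrightarrow> sets (\<mu> m) = sets borel"
    and "\<And>m. m \<in> {1..k} \<Longrightarrow> finite_measure (\<mu> m)"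
    and "\<And>m. m \<in> {1..k} \<Longrightarrow> emeasure (\<mu> m) UNIV \<noteq> 0"
    and "\<And>m. m \<in> {1..k} \<Longrightarrow> compact (measure_support (\<mu> m))"
    and "1 \<le> q"
    and "1 \<le> p"
    and "\<exists>C::real. 0 < C \<and>
           (\<forall>f. (\<forall>m\<in>{1..k}. f m \<in> Lp_space p (\<mu> m)) \<longrightarrow>
             Lp_norm q lborel (\<lambda>\<xi>. \<Prod>m=1..k. fourier_density (f m) (\<mu> m) \<xi>)
               \<le> ennreal C * (\<Prod>m=1..k. Lp_norm p (\<mu> m) (f m)))"
  shows "q \<ge> ereal (2 * real CARD('d)) / (\<Sum>m=1..k. upper_box_dim (measure_support (\<mu> m)))"
proof (cases "q = \<infinity>")
  case True
  then show ?thesis by simp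
next
  case False
  then obtain r where r: "q = ereal r" "1 \<le> r"
    using assms(6) by (cases q) auto
  obtain C where C: "0 < C" "\<And>f. (\<And>m. m \<in> {1..k} \<Longrightarrow> f m \<in> Lp_space p (\<mu> m)) \<Longrightarrow>
      Lp_norm (ereal r) lborel (\<lambda>\<xi>. \<Prod>m=1..k. fourier_density (f m) (\<mu> m) \<xi>)
        \<le> ennreal C * (\<Prod>m=1..k. Lp_norm p (\<mu> m) (f m))"
    using assms(8) unfolding r(1) by blast
  obtain c where c: "c > 0"
    "\<And>m \<delta>. m \<in> {1..k} \<Longrightarrow> \<delta> > 0 \<Longrightarrow> covering_number \<delta> (measure_support (\<mu> m)) \<ge> 1"
    "\<And>\<delta>. \<delta> > 0 \<Longrightarrow> c * \<delta> powr (- (2 * real DIM(real ^ 'd) / r))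
      \<le> (\<Prod>m=1..k. real (covering_number \<delta> (measure_support (\<mu> m))))"
    using prod_covering_number_ge[OF finite_atLeastAtMost assms(2-5,7) r(2) C] by metis
  define S where "S = (\<Sum>m=1..k. upper_box_dim (measure_support (\<mu> m)))"
  have S: "ereal (2 * real CARD('d) / r) \<le> S"
    using sum_upper_box_dim_ge[OF finite_atLeastAtMost c] by (simp add: S_def)
  \<comment> \<open>Positivity of \<open>S\<close> rules out the quotient by 0, which would be
    \<infinity>; for \<open>S = \<infinity>\<close> the quotient is 0.\<close>
  have "0 < 2 * real CARD('d) / r" using r by simp
  then have "0 < S" using S by (metis ereal_less(2) less_le_trans)
  have "ereal (2 * real CARD('d)) / S \<le> ereal r"
  proof (cases S)
    case (real s)
    then show ?thesis using S \<open>0 < S\<close> r by (simp add: field_simps)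
  qed (use S r in auto)
  then show ?thesis by (simp add: S_def r(1))
qed

end
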